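(* Let $\mathcal{I}=[0,\infty)$, let $F_0:\mathcal{I}^2\to\mathcal{I}$ be a sufficiently smooth map with $F_0(1,1)=1$, and let $F_j:\mathcal{I}\times\mathcal{I}\to\mathcal{I}$ be an expansion of $F_0$ (for some integer $j\ge 0$) such that $F_j$ is increasing in its second argument. Suppose the fixed point $\bar x=1$ is unique and locally asymptotically stable. If $g:\mathcal{I}\to\mathcal{I}$ is a continuous decreasing function such that $$\min\{x,g(x)\}<F_j(x,g(x))<\max\{x,g(x)\}\quad\text{for all } x\neq 1,$$ then $g$ is an enveloping of $F_j$.
   Context: Expansions: for the difference equation $x_{n+1}=F_0(x_n,x_{n-1})$, the expansions are the maps $F_j:\mathcal{I}^2\to\mathcal{I}$ defined by $F_{j+1}(x,y)=F_j(F_0(x,y),x)$, $j\ge 0$. A fixed point of a two-variable map $F$ is $\bar x$ with $F(\bar x,\bar x)=\bar x$. Local asymptotic stability (LAS) of $\bar x=1$: with $(a_1,a_2)=\nabla F_0(1,1)$, the eigenvalues of $\begin{bmatrix}a_1&a_2\\1&0\end{bmatrix}$ lie in the open unit disk. Standing assumptions on the expansion $F_j$ considered: it satisfies $\|\nabla F_j(1,1)\|_1<1$ (sum of the absolute values of the two partial derivatives), and the curves $y=F_j(x,y)$ and $x=F_j(x,y)$ have a unique intersection in the interior of the positive quadrant, namely $(1,1)$. Enveloping: a continuous map $g:\mathcal{I}\to\mathcal{I}$ is an enveloping of $F:\mathcal{I}^2\to\mathcal{I}$ if (i) $g$ and $F$ share the fixed point $1$; (ii) $g$ is decreasing; (iii)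 for all $(x_1,x_2)\in\mathcal{I}^2$ with $(x_1,x_2)\ne(1,1)$, writing $\alpha=\min\{x_1,x_2\}$, $\beta=\max\{x_1,x_2\}$, $z=F(x_1,x_2)$: whenever $z\notin(\alpha,\beta)$, either $g(\beta)<z\le\alpha$ or $g(\alpha)>z\ge\beta$.
   Formalization: The standing assumption that y=F_j(x,y) is a curve is taken to mean that its solution set in the closed quadrant is connected; if it may have several components, the claim is false. *)

theory Defs
  imports "HOL-Analysis.Analysis" "Jordan_Normal_Form.Char_Poly"
begin

text \<open>
  The interval is \<open>[0, \<infinity>)\<close>, written \<open>{0..}\<close>. Maps on it, or on its square, are total functions
  whose values off \<open>{0..}\<close> are irrelevant.
\<close>

abbreviation quadrant :: "(real \<times> real) set" where
  "quadrant \<equiv> {0..} \<times> {0..}"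

definition maps_quadrant :: "(real \<Rightarrow> real \<Rightarrow> real) \<Rightarrow> bool" where
  "maps_quadrant F \<longleftrightarrow> (\<forall>x\<ge>0. \<forall>y\<ge>0. F x y \<ge> 0)"

text \<open>
  Continuous differentiability up to the boundary of the closed quadrant: on the axes the
  derivatives are taken within the quadrant, hence one-sided.
\<close>

definition C1_quadrant :: "(real \<Rightarrow> real \<Rightarrow> real) \<Rightarrow> bool" where
  "C1_quadrant F \<longleftrightarrow>
    (\<exists>D1 D2 :: real \<times> real \<Rightarrow> real.
       continuous_on quadrant D1 \<and> continuous_on quadrant D2 \<and>
       (\<forall>p\<in>quadrant. ((\<lambda>(x, y). F x y) has_derivative (\<lambda>(h, k). D1 p * h + D2 p * k))
                       (at p within quadrant)))"

primrec expansion :: "(real \<Rightarrow> real \<Rightarrow> real) \<Rightarrow> nat \<Rightarrow> real \<Rightarrow> real \<Rightarrow> real" where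
  "expansion F0 0 = F0"
| "expansion F0 (Suc j) = (\<lambda>x y. expansion F0 j (F0 x y) x)"

definition fixed_points :: "(real \<Rightarrow> real \<Rightarrow> real) \<Rightarrow> real set" where
  "fixed_points F = {x. x \<ge> 0 \<and> F x x = x}"

definition partial1 :: "(real \<Rightarrow> real \<Rightarrow> real) \<Rightarrow> real \<Rightarrow> real \<Rightarrow> real" where
  "partial1 F x y = deriv (\<lambda>s. F s y) x"

definition partial2 :: "(real \<Rightarrow> real \<Rightarrow> real) \<Rightarrow> real \<Rightarrow> real \<Rightarrow> real" where
  "partial2 F x y = deriv (\<lambda>t. F x t) y"

definition jacobian_at_1 :: "(real \<Rightarrow> real \<Rightarrow> real) \<Rightarrow> complex mat" where
  "jacobian_at_1 F =
     mat_of_rows_list 2 [[complex_of_real (partial1 F 1 1), complex_of_real (partial2 F 1 1)],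
                         [1, 0]]"

definition LAS_at_1 :: "(real \<Rightarrow> real \<Rightarrow> real) \<Rightarrow> bool" where
  "LAS_at_1 F \<longleftrightarrow> (\<forall>k. eigenvalue (jacobian_at_1 F) k \<longrightarrow> cmod k < 1)"

definition y_curve :: "(real \<Rightarrow> real \<Rightarrow> real) \<Rightarrow> (real \<times> real) set" where
  "y_curve F = {(x, y) \<in> quadrant. y = F x y}"

definition x_curve :: "(real \<Rightarrow> real \<Rightarrow> real) \<Rightarrow> (real \<times> real) set" where
  "x_curve F = {(x, y) \<in> quadrant. x = F x y}"

text \<open>
  The requirement that \<open>y = F x y\<close> be a curve is kept as connectedness: the solution set of an
  equation may have several components, and a component of \<open>y_curve F\<close> away from \<open>(1, 1)\<close>
  is not excluded by the condition on the intersection, because \<open>y_curve F\<close> and \<open>x_curve F\<close> only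
  meet on the diagonal.
\<close>

definition standing_assumptions :: "(real \<Rightarrow> real \<Rightarrow> real) \<Rightarrow> bool" where
  "standing_assumptions F \<longleftrightarrow>
     \<bar>partial1 F 1 1\<bar> + \<bar>partial2 F 1 1\<bar> < 1 \<and>
     connected (y_curve F) \<and>
     y_curve F \<inter> x_curve F \<inter> ({0<..} \<times> {0<..}) = {(1, 1)}"

definition enveloping :: "(real \<Rightarrow> real) \<Rightarrow> (real \<Rightarrow> real \<Rightarrow> real) \<Rightarrow> bool" where
  "enveloping g F \<longleftrightarrow>
     g ` {0..} \<subseteq> {0..} \<and> continuous_on {0..} g \<and>
     g 1 = 1 \<and> F 1 1 = 1 \<and>
     strict_antimono_on {0..} g \<and>
     (\<forall>x1\<ge>0. \<forall>x2\<ge>0. (x1, x2) \<noteq> (1, 1) \<longrightarrow>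
        (let \<alpha> = min x1 x2; \<beta> = max x1 x2; z = F x1 x2
         in z \<notin> {\<alpha><..<\<beta>} \<longrightarrow> (g \<beta> < z \<and> z \<le> \<alpha>) \<or> (g \<alpha> > z \<and> z \<ge> \<beta>)))"

end

theory Submission
  imports Defs
begin

text \<open>
  Write \<open>F\<close> for the expansion. Comparing \<open>z = F x1 x2\<close> with \<open>F x1 (g x1)\<close>, about which the
  betweenness hypothesis speaks, is easy by monotonicity whenever it is known on which side of
  \<open>g x1\<close> the second argument \<open>x2\<close> lies. What remains to be excluded is that \<open>F x1 x2 \<le> x2\<close> with
  \<open>x2\<close> below both \<open>x1\<close> and \<open>g x1\<close>, or \<open>F x1 x2 \<ge> x2\<close> with \<open>x2\<close> above both. By the intermediate
  value theorem on the vertical line through \<open>x1\<close>, such a point would produce a point of the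
  curve \<open>y = F x y\<close> in the region \<open>y < min x (g x)\<close> or in the region \<open>y > max x (g x)\<close>.

  The curve enters neither region. It meets the diagonal only at the unique fixed point, and the
  graph of \<open>g\<close> only at \<open>(1, 1)\<close> by the betweenness hypothesis, so it could enter only through
  \<open>(1, 1)\<close>, being connected. Near \<open>(1, 1)\<close> this is impossible: the second partial derivative of
  \<open>F\<close> is below \<open>1\<close> there, so \<open>y \<mapsto> F x y - y\<close> decreases strictly, and its signs on the diagonal
  and on the graph of \<open>g\<close> force \<open>F x y > y\<close> in the lower region and \<open>F x y < y\<close> in the upper one.
  This is \<open>y_curve_between\<close>; \<open>F_above_below_region\<close> and \<open>F_below_above_region\<close> draw the
  conclusion for the sign of \<open>F x y - y\<close>, and \<open>undershoot\<close> and \<open>overshoot\<close> finish the comparison.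

  The argument also uses that \<open>F x x > x\<close> for \<open>x < 1\<close> and \<open>F x x < x\<close> for \<open>x > 1\<close>
  (\<open>diagonal_side\<close>): the sign is constant on each side by uniqueness of the fixed point, it is
  positive at \<open>0\<close> because \<open>F\<close> is nonnegative and \<open>0\<close> is not fixed, and negative just to the right of \<open>1\<close> because the
  partial derivatives of \<open>F\<close> at \<open>(1, 1)\<close> have a sum below \<open>1\<close>.
\<close>

section \<open>A sign argument on connected sets\<close>

text \<open>
  The set where \<open>h\<close> is positive is open in \<open>S\<close>. It is also closed: the only zero of \<open>h\<close> that could
  be a limit of positive values is \<open>p\<close>, and a neighbourhood of \<open>p\<close> contains none. It misses \<open>p\<close>,
  so by connectedness it is empty.
\<close>

lemma connected_nonpos_if_nonzero_off_point:
  fixes h :: "'a::topological_space \<Rightarrow> real"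
  assumes "connected S" "continuous_on S h" "p \<in> S"
    and nonzero: "\<And>q. q \<in> S \<Longrightarrow> q \<noteq> p \<Longrightarrow> h q \<noteq> 0"
    and V: "open V" "p \<in> V" "\<And>q. q \<in> S \<inter> V \<Longrightarrow> h q \<le> 0"
    and "q \<in> S"
  shows "h q \<le> 0"
proof -
  define P where "P = S \<inter> h -` {0<..}"
  have "openin (top_of_set S) P"
    unfolding P_def using assms(2) by (rule continuous_openin_preimage_gen) simp
  moreover have "P = (S \<inter> h -` {0..}) \<inter> (S - V)"
    unfolding P_def using nonzero V by (fastforce simp: less_le)
  moreover have "closedin (top_of_set S) (S \<inter> h -` {0..})"
    using assms(2) by (rule continuous_closedin_preimage) simp
  moreover have "closedin (top_of_set S) (S - V)"
    by (metis Diff_Int_distrib2 Diff_eq V(1) closed_Compl closedin_closed_Int)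
  ultimately have "P = {} \<or> P = S"
    using \<open>connected S\<close> by (metis closedin_Int connected_clopen)
  moreover have "p \<notin> P"
    using V \<open>p \<in> S\<close> by (force simp: P_def)
  ultimately show ?thesis
    using \<open>p \<in> S\<close> \<open>q \<in> S\<close> by (force simp: P_def)
qed

section \<open>Maps squeezed along a decreasing function\<close>

text \<open>
  The properties of \<open>F\<close> and \<open>g\<close> on which the enveloping property rests. Uniqueness of the fixed
  point and the bounds on the derivatives of \<open>F\<close> at \<open>(1, 1)\<close> are represented by what they imply:
  the signs of \<open>F x x - x\<close> on both sides of \<open>1\<close>, and the strict decrease of \<open>y \<mapsto> F x y - y\<close> in a
  box around \<open>(1, 1)\<close>.
\<close>

locale squeezed_feedback =
  fixes F :: "real \<Rightarrow> real \<Rightarrow> real" and g :: "real \<Rightarrow> real"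
  assumes F_continuous: "continuous_on quadrant (\<lambda>(x, y). F x y)"
    and F_nonneg: "\<And>x y. 0 \<le> x \<Longrightarrow> 0 \<le> y \<Longrightarrow> 0 \<le> F x y"
    and F_increasing: "\<And>x. 0 \<le> x \<Longrightarrow> strict_mono_on {0..} (F x)"
    and F_fix: "F 1 1 = 1"
    and F_diagonal_left: "\<And>x. 0 \<le> x \<Longrightarrow> x < 1 \<Longrightarrow> x < F x x"
    and F_diagonal_right: "\<And>x. 1 < x \<Longrightarrow> F x x < x"
    and connected_y_curve: "connected (y_curve F)"
    and F_locally_contracting:
      "\<exists>\<delta>>0. \<forall>x y y'. \<bar>x - 1\<bar> < \<delta> \<longrightarrow> \<bar>y - 1\<bar> < \<delta> \<longrightarrow> \<bar>y' - 1\<bar> < \<delta> \<longrightarrow> y < y' \<longrightarrow>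
         F x y' - F x y < y' - y"
    and g_nonneg: "\<And>x. 0 \<le> x \<Longrightarrow> 0 \<le> g x"
    and g_continuous: "continuous_on {0..} g"
    and g_decreasing: "strict_antimono_on {0..} g"
    and squeezed: "\<And>x. 0 \<le> x \<Longrightarrow> x \<noteq> 1 \<Longrightarrow> min x (g x) < F x (g x) \<and> F x (g x) < max x (g x)"
begin

lemma F_less: "0 \<le> x \<Longrightarrow> 0 \<le> y \<Longrightarrow> y < y' \<Longrightarrow> F x y < F x y'"
  using F_increasing[of x] by (auto simp: strict_mono_on_def)

lemma F_le: "0 \<le> x \<Longrightarrow> 0 \<le> y \<Longrightarrow> y \<le> y' \<Longrightarrow> F x y \<le> F x y'"
  using F_less[of x y y'] by (cases "y = y'") auto

lemma g_less: "0 \<le> x \<Longrightarrow> x < x' \<Longrightarrow> g x' < g x"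
  using g_decreasing by (auto simp: monotone_on_def)

text \<open>
  A decreasing continuous self-map of the half-line has a fixed point, found between \<open>0\<close> and
  \<open>g 0\<close>. At a fixed point of \<open>g\<close> the strict inequalities of \<open>squeezed\<close> would have equal bounds, so
  it can only be \<open>1\<close>.
\<close>

lemma g_fix: "g 1 = 1"
proof -
  have "continuous_on {0..g 0} (\<lambda>x. x - g x)"
    by (intro continuous_intros continuous_on_subset[OF g_continuous]) auto
  moreover have "g (g 0) \<le> g 0"
    using g_less[of 0 "g 0"] g_nonneg[of 0] by (cases "g 0 = 0") auto
  ultimately obtain x where "0 \<le> x" "x - g x = 0"
    using IVT'[of "\<lambda>x. x - g x" 0 0 "g 0"] g_nonneg[of 0] by auto
  then show ?thesis
    using squeezed[of x] by (cases "x = 1") auto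
qed

lemma squeezed_left:
  assumes "0 \<le> x" "x < 1"
  shows "1 < g x" "x < F x (g x)" "F x (g x) < g x"
proof -
  show "1 < g x" using g_less[of x 1] assms by (simp add: g_fix)
  then show "x < F x (g x)" "F x (g x) < g x"
    using squeezed[of x] assms by auto
qed

lemma squeezed_right:
  assumes "1 < x"
  shows "g x < 1" "g x < F x (g x)" "F x (g x) < x"
proof -
  show "g x < 1" using g_less[of 1 x] assms by (simp add: g_fix)
  then show "g x < F x (g x)" "F x (g x) < x"
    using squeezed[of x] assms by auto
qed

lemma one_in_y_curve: "(1, 1) \<in> y_curve F"
  by (simp add: y_curve_def F_fix)

lemma F_slice_continuous: "0 \<le> x \<Longrightarrow> a \<ge> 0 \<Longrightarrow> continuous_on {a..b} (\<lambda>y. F x y - y)"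
proof -
  assume *: "0 \<le> x" "a \<ge> 0"
  have "continuous_on {a..b} (\<lambda>y. (\<lambda>(x, y). F x y) (x, y))"
    by (rule continuous_on_compose2[OF F_continuous]) (use * in \<open>auto intro!: continuous_intros\<close>)
  then show ?thesis by (auto intro!: continuous_intros)
qed

lemma g_fst_continuous: "continuous_on (y_curve F) (\<lambda>q. g (fst q))"
  by (rule continuous_on_compose2[OF g_continuous])
    (auto intro!: continuous_intros simp: y_curve_def)

lemma crossing_only_at_one:
  assumes "(x, y) \<in> y_curve F" "y = x \<or> y = g x"
  shows "(x, y) = (1, 1)"
proof -
  have "0 \<le> x" "y = F x y" using assms(1) by (auto simp: y_curve_def)
  then show ?thesis
    using assms(2) F_diagonal_left[of x] F_diagonal_right[of x] squeezed_left[of x]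
      squeezed_right[of x] g_fix
    by (cases x "1::real" rule: linorder_cases) auto
qed

text \<open>
  The boundary of the lower region is the diagonal for \<open>x \<le> 1\<close> and the graph of \<open>g\<close> for
  \<open>x \<ge> 1\<close>; on it \<open>F x y - y\<close> is nonnegative. Moving down from the boundary inside the box where
  \<open>F x y - y\<close> decreases in \<open>y\<close> makes it positive. The upper region is symmetric. The bound \<open>e\<close>
  is chosen so small that the boundary point \<open>(x, g x)\<close> lies in the box as well.
\<close>

lemma local_side:
  obtains e where "0 < e"
    "\<And>x y. \<lbrakk>\<bar>x - 1\<bar> < e; \<bar>y - 1\<bar> < e; 0 \<le> x; y < min x (g x)\<rbrakk> \<Longrightarrow> y < F x y"
    "\<And>x y. \<lbrakk>\<bar>x - 1\<bar> < e; \<bar>y - 1\<bar> < e; 0 \<le> x; max x (g x) < y\<rbrakk> \<Longrightarrow> F x y < y"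
proof -
  obtain \<delta> where "\<delta> > 0" and \<delta>: "\<And>x y y'. \<lbrakk>\<bar>x - 1\<bar> < \<delta>; \<bar>y - 1\<bar> < \<delta>; \<bar>y' - 1\<bar> < \<delta>; y < y'\<rbrakk> \<Longrightarrow>
      F x y' - F x y < y' - y"
    using F_locally_contracting by metis
  obtain \<epsilon> where "\<epsilon> > 0" and \<epsilon>: "\<And>x. 0 \<le> x \<Longrightarrow> \<bar>x - 1\<bar> < \<epsilon> \<Longrightarrow> \<bar>g x - 1\<bar> < \<delta>"
    using g_continuous \<open>\<delta> > 0\<close> by (force simp: continuous_on_iff dist_real_def g_fix)
  define e where "e = min \<delta> \<epsilon>"
  show thesis
  proof (rule that[of e])
    show "0 < e" using \<open>\<delta> > 0\<close> \<open>\<epsilon> > 0\<close> by (simp add: e_def)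
    fix x y assume *: "\<bar>x - 1\<bar> < e" "\<bar>y - 1\<bar> < e" "0 \<le> x"
    then have in_box: "\<bar>x - 1\<bar> < \<delta>" "\<bar>y - 1\<bar> < \<delta>" "\<bar>g x - 1\<bar> < \<delta>"
      using \<epsilon>[of x] by (auto simp: e_def)
    show "y < F x y" if "y < min x (g x)"
    proof (cases "x \<le> 1")
      case True
      then have "x \<le> F x x" using F_diagonal_left[of x] F_fix * by (cases "x = 1") auto
      then show ?thesis using \<delta>[of x y x] in_box that by auto
    next
      case False
      then show ?thesis using \<delta>[of x y "g x"] squeezed_right[of x] in_box that by auto
    qed
    show "F x y < y" if "max x (g x) < y"
    proof (cases "x < 1")
      case True
      then show ?thesis using \<delta>[of x "g x" y] squeezed_left[of x] in_box that * by auto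
    next
      case False
      then have "F x x \<le> x" using F_diagonal_right[of x] F_fix by (cases "x = 1") auto
      then show ?thesis using \<delta>[of x x y] in_box that by auto
    qed
  qed
qed

text \<open>
  The curve touches the boundary of either region only at \<open>(1, 1)\<close>, and avoids both regions near
  that point, so connectedness keeps it outside them altogether.
\<close>

lemma y_curve_between:
  assumes "(x, y) \<in> y_curve F"
  shows "min x (g x) \<le> y" "y \<le> max x (g x)"
proof -
  obtain e where e: "0 < e"
    "\<And>x y. \<lbrakk>\<bar>x - 1\<bar> < e; \<bar>y - 1\<bar> < e; 0 \<le> x; y < min x (g x)\<rbrakk> \<Longrightarrow> y < F x y"
    "\<And>x y. \<lbrakk>\<bar>x - 1\<bar> < e; \<bar>y - 1\<bar> < e; 0 \<le> x; max x (g x) < y\<rbrakk> \<Longrightarrow> F x y < y"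
    using local_side by metis
  define V where "V = {1 - e<..<1 + e} \<times> {1 - e<..<1 + e}"
  have V: "open V" "(1, 1) \<in> V"
    using e(1) by (simp_all add: V_def open_Times)
  have in_V: "\<bar>fst q - 1\<bar> < e" "\<bar>snd q - 1\<bar> < e" if "q \<in> V" for q
    using that by (auto simp: V_def)
  have in_curve: "0 \<le> fst q" "F (fst q) (snd q) = snd q" if "q \<in> y_curve F" for q
    using that by (auto simp: y_curve_def)
  have "min (fst q) (g (fst q)) - snd q \<noteq> 0" "snd q - max (fst q) (g (fst q)) \<noteq> 0"
    if "q \<in> y_curve F" "q \<noteq> (1, 1)" for q
    using that crossing_only_at_one[of "fst q" "snd q"] by (auto simp: min_def max_def)
  note nonzero = this
  have "min (fst (x, y)) (g (fst (x, y))) - snd (x, y) \<le> 0"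
    using connected_y_curve _ one_in_y_curve nonzero(1) V(1,2) _ assms
  proof (rule connected_nonpos_if_nonzero_off_point)
    show "continuous_on (y_curve F) (\<lambda>q. min (fst q) (g (fst q)) - snd q)"
      by (intro continuous_intros g_fst_continuous)
    show "min (fst q) (g (fst q)) - snd q \<le> 0" if "q \<in> y_curve F \<inter> V" for q
      using e(2)[of "fst q" "snd q"] in_V[of q] in_curve[of q] that by fastforce
  qed
  then show "min x (g x) \<le> y" by simp
  have "snd (x, y) - max (fst (x, y)) (g (fst (x, y))) \<le> 0"
    using connected_y_curve _ one_in_y_curve nonzero(2) V(1,2) _ assms
  proof (rule connected_nonpos_if_nonzero_off_point)
    show "continuous_on (y_curve F) (\<lambda>q. snd q - max (fst q) (g (fst q)))"
      by (intro continuous_intros g_fst_continuous)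
    show "snd q - max (fst q) (g (fst q)) \<le> 0" if "q \<in> y_curve F \<inter> V" for q
      using e(3)[of "fst q" "snd q"] in_V[of q] in_curve[of q] that by fastforce
  qed
  then show "y \<le> max x (g x)" by simp
qed

text \<open>
  Since \<open>F x 0 \<ge> 0\<close>, a sign change of \<open>F x t - t\<close> on \<open>[0, y]\<close> would be a point of the curve in the
  lower region.
\<close>

lemma F_above_below_region:
  assumes "0 \<le> x" "0 \<le> y" "y < min x (g x)"
  shows "y < F x y"
proof (rule ccontr)
  assume "\<not> y < F x y"
  then obtain t where "0 \<le> t" "t \<le> y" "F x t - t = 0"
    using IVT2'[of "\<lambda>t. F x t - t" y 0 0] F_slice_continuous[of x 0 y] F_nonneg[of x 0] assms
    by auto
  then show False
    using y_curve_between(1)[of x t] assms by (auto simp: y_curve_def)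
qed

text \<open>
  As in the lower region, but the intermediate value theorem starts at the lower end
  \<open>max x (g x)\<close> of the vertical line, where \<open>F x t - t\<close> is negative if \<open>x \<noteq> 1\<close>. For
  \<open>x = 1\<close> this end is the point \<open>(1, 1)\<close>, where the difference vanishes, and one has to start at a nearby point above, supplied by
  \<open>local_side\<close>.
\<close>

lemma F_below_above_region:
  assumes "0 \<le> x" "max x (g x) < y"
  shows "F x y < y"
proof (rule ccontr)
  assume not_less: "\<not> F x y < y"
  obtain m where m: "max x (g x) < m" "m \<le> y" "F x m < m"
  proof (cases "x = 1")
    case True
    obtain e where e: "0 < e"
      "\<And>x y. \<lbrakk>\<bar>x - 1\<bar> < e; \<bar>y - 1\<bar> < e; 0 \<le> x; y < min x (g x)\<rbrakk> \<Longrightarrow> y < F x y"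
      "\<And>x y. \<lbrakk>\<bar>x - 1\<bar> < e; \<bar>y - 1\<bar> < e; 0 \<le> x; max x (g x) < y\<rbrakk> \<Longrightarrow> F x y < y"
      using local_side by metis
    have "1 < y" using assms True by (simp add: g_fix)
    define m where "m = min y (1 + e / 2)"
    have "1 < m" "m \<le> y" "\<bar>m - 1\<bar> < e"
      using \<open>0 < e\<close> \<open>1 < y\<close> by (auto simp: m_def min_def)
    then show thesis
      using that[of m] e(3)[of 1 m] e(1) True by (auto simp: g_fix)
  next
    case False
    define m0 where "m0 = max x (g x)"
    have "F x m0 < m0"
      using False assms squeezed_left[of x] squeezed_right[of x] F_diagonal_right[of x]
      by (cases "x < 1") (auto simp: m0_def max_def)
    then obtain t where "m0 \<le> t" "t \<le> y" "F x t - t = 0"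
      using IVT'[of "\<lambda>t. F x t - t" m0 0 y] F_slice_continuous[of x m0 y] not_less assms
      by (auto simp: m0_def)
    moreover from this have "(x, t) \<in> y_curve F"
      using assms by (auto simp: y_curve_def m0_def)
    ultimately have "t = m0" "F x t = t"
      using y_curve_between(2)[of x t] by (auto simp: m0_def)
    with \<open>F x m0 < m0\<close> have False by simp
    then show thesis ..
  qed
  then obtain t where "m \<le> t" "t \<le> y" "F x t - t = 0"
    using IVT'[of "\<lambda>t. F x t - t" m 0 y] F_slice_continuous[of x m y] not_less assms
    by auto
  then show False
    using y_curve_between(2)[of x t] assms m by (auto simp: y_curve_def)
qed

text \<open>
  If \<open>x1 < x2\<close>, lowering the second argument to \<open>x1\<close> shows \<open>F x1 x1 < F x1 x2 \<le> x1\<close>, hence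
  \<open>1 < x1\<close>; then \<open>g x1 < 1 < x2\<close>, and \<open>g x2 < g x1 < F x1 (g x1) < F x1 x2\<close>. If \<open>x1 \<ge> x2\<close>, then
  \<open>x1 \<le> 1\<close> is impossible: the point would lie on the diagonal left of \<open>1\<close> or in the lower region,
  where \<open>F x1 x2 > x2\<close>;
  and for \<open>x1 > 1\<close> the lower region is excluded in the same way, which leaves \<open>x2 \<ge> g x1\<close> and
  \<open>F x1 x2 \<ge> F x1 (g x1) > g x1\<close>.
\<close>

lemma undershoot:
  assumes "0 \<le> x1" "0 \<le> x2" "(x1, x2) \<noteq> (1, 1)" "F x1 x2 \<le> min x1 x2"
  shows "g (max x1 x2) < F x1 x2"
proof (cases "x1 < x2")
  case True
  then have "F x1 x1 < x1" using F_less[of x1 x1 x2] assms by auto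
  then have "1 < x1"
    using F_diagonal_left[of x1] F_fix assms by (cases x1 "1::real" rule: linorder_cases) auto
  then have "g x2 < g x1" "g x1 < F x1 (g x1)" "F x1 (g x1) < F x1 x2"
    using True g_less[of x1 x2] squeezed_right[of x1] F_less[of x1 "g x1" x2] g_nonneg[of x1]
    by auto
  with True show ?thesis by auto
next
  case False
  show ?thesis
  proof (cases "x1 \<le> 1")
    case True
    have "x2 < F x1 x2"
    proof (cases "x2 = x1")
      case True
      then show ?thesis using \<open>x1 \<le> 1\<close> F_diagonal_left[of x1] assms by auto
    next
      case False
      then have "x2 < g x1"
        using \<open>\<not> x1 < x2\<close> \<open>x1 \<le> 1\<close> squeezed_left[of x1] g_fix assms by (cases "x1 = 1") auto
      with False show ?thesis
        using \<open>\<not> x1 < x2\<close> F_above_below_region[of x1 x2] assms by auto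
    qed
    then show ?thesis using assms by auto
  next
    case right: False
    have "g x1 \<le> x2"
      using F_above_below_region[of x1 x2] False right squeezed_right[of x1] assms by fastforce
    then show ?thesis
      using False right squeezed_right[of x1] F_le[of x1 "g x1" x2] g_nonneg[of x1] assms by auto
  qed
qed

text \<open>
  The mirror image of \<open>undershoot\<close>, with the upper region in place of the lower one.
\<close>

lemma overshoot:
  assumes "0 \<le> x1" "0 \<le> x2" "(x1, x2) \<noteq> (1, 1)" "max x1 x2 \<le> F x1 x2"
  shows "F x1 x2 < g (min x1 x2)"
proof (cases "x2 < x1")
  case True
  then have "x1 < F x1 x1" using F_less[of x1 x2 x1] assms by auto
  then have "x1 < 1"
    using F_diagonal_right[of x1] F_fix assms by (cases x1 "1::real" rule: linorder_cases) auto
  then have "F x1 x2 < F x1 (g x1)" "F x1 (g x1) < g x1" "g x1 < g x2"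
    using True g_less[of x2 x1] squeezed_left[of x1] F_less[of x1 x2 "g x1"] assms
    by auto
  with True show ?thesis by auto
next
  case False
  show ?thesis
  proof (cases "1 \<le> x1")
    case True
    have "F x1 x2 < x2"
    proof (cases "x2 = x1")
      case True
      then show ?thesis using \<open>1 \<le> x1\<close> F_diagonal_right[of x1] assms by auto
    next
      case False
      then have "g x1 < x2"
        using \<open>\<not> x2 < x1\<close> \<open>1 \<le> x1\<close> squeezed_right[of x1] g_fix by (cases "x1 = 1") auto
      with False show ?thesis
        using \<open>\<not> x2 < x1\<close> F_below_above_region[of x1 x2] assms by auto
    qed
    then show ?thesis using assms by auto
  next
    case left: False
    have "x2 \<le> g x1"
      using F_below_above_region[of x1 x2] False left squeezed_left[of x1] assms by fastforce
    then show ?thesis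
      using False left squeezed_left[of x1] F_le[of x1 x2 "g x1"] assms by auto
  qed
qed

lemma enveloping: "enveloping g F"
proof -
  have "g (max x1 x2) < F x1 x2 \<and> F x1 x2 \<le> min x1 x2 \<or>
      F x1 x2 < g (min x1 x2) \<and> max x1 x2 \<le> F x1 x2"
    if "0 \<le> x1" "0 \<le> x2" "(x1, x2) \<noteq> (1, 1)" "F x1 x2 \<notin> {min x1 x2<..<max x1 x2}" for x1 x2
  proof -
    have "F x1 x2 \<le> min x1 x2 \<or> max x1 x2 \<le> F x1 x2"
      using that(4) unfolding greaterThanLessThan_iff de_Morgan_conj not_less .
    then show ?thesis
      using undershoot[OF that(1-3)] overshoot[OF that(1-3)] by blast
  qed
  moreover have "g ` {0..} \<subseteq> {0..}" using g_nonneg by auto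
  ultimately show ?thesis
    unfolding enveloping_def Let_def
    by (intro conjI allI impI g_continuous g_fix F_fix g_decreasing) assumption+
qed

end

section \<open>Continuous differentiability of expansions\<close>

lemma maps_quadrant_expansion:
  "maps_quadrant F \<Longrightarrow> maps_quadrant (expansion F j)"
  by (induction j) (auto simp: maps_quadrant_def)

text \<open>
  Continuous differentiability with the two partial derivatives as parameters, which gives the
  derivatives names in the chain rule.
\<close>

definition has_partials_on_quadrant ::
  "(real \<Rightarrow> real \<Rightarrow> real) \<Rightarrow> (real \<times> real \<Rightarrow> real) \<Rightarrow> (real \<times> real \<Rightarrow> real) \<Rightarrow> bool" where
  "has_partials_on_quadrant F D1 D2 \<longleftrightarrow>
     continuous_on quadrant D1 \<and> continuous_on quadrant D2 \<and>
     (\<forall>p\<in>quadrant. ((\<lambda>(x, y). F x y) has_derivative (\<lambda>(h, k). D1 p * h + D2 p * k))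
                     (at p within quadrant))"

lemma C1_quadrant_iff_has_partials: "C1_quadrant F \<longleftrightarrow> (\<exists>D1 D2. has_partials_on_quadrant F D1 D2)"
  unfolding C1_quadrant_def has_partials_on_quadrant_def ..

lemma C1_quadrantE:
  assumes "C1_quadrant F"
  obtains D1 D2 where "has_partials_on_quadrant F D1 D2"
  using assms C1_quadrant_iff_has_partials by blast

lemma has_partials_onD:
  assumes "has_partials_on_quadrant F D1 D2"
  shows "continuous_on quadrant D1" "continuous_on quadrant D2"
    "p \<in> quadrant \<Longrightarrow> ((\<lambda>(x, y). F x y) has_derivative (\<lambda>(h, k). D1 p * h + D2 p * k))
       (at p within quadrant)"
  using assms unfolding has_partials_on_quadrant_def by blast+

lemma C1_quadrant_continuous:
  assumes "C1_quadrant F"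
  shows "continuous_on quadrant (\<lambda>(x, y). F x y)"
proof (unfold continuous_on_eq_continuous_within, rule ballI)
  fix p :: "real \<times> real"
  assume "p \<in> quadrant"
  then obtain f' where "((\<lambda>(x, y). F x y) has_derivative f') (at p within quadrant)"
    using assms unfolding C1_quadrant_def by blast
  then show "continuous (at p within quadrant) (\<lambda>(x, y). F x y)"
    by (rule has_derivative_continuous)
qed

text \<open>
  The chain rule for \<open>F\<close> after \<open>(x, y) \<mapsto> (G x y, x)\<close>, the substitution that produces the next
  expansion. The derivatives within the quadrant compose because this substitution maps the
  quadrant into itself.
\<close>

lemma C1_quadrant_substitute:
  assumes F: "C1_quadrant F" and G: "C1_quadrant G" and "maps_quadrant G"
  shows "C1_quadrant (\<lambda>x y. F (G x y) x)"
proof -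
  define \<Phi> where "\<Phi> = (\<lambda>p. ((\<lambda>(x, y). G x y) p, fst p :: real))"
  obtain A B where AB: "has_partials_on_quadrant F A B"
    using F by (rule C1_quadrantE)
  obtain C D where CD: "has_partials_on_quadrant G C D"
    using G by (rule C1_quadrantE)
  have image: "\<Phi> ` quadrant \<subseteq> quadrant"
  proof (rule image_subsetI)
    fix p :: "real \<times> real"
    assume "p \<in> quadrant"
    then have "0 \<le> fst p" "0 \<le> snd p" by auto
    with \<open>maps_quadrant G\<close> show "\<Phi> p \<in> quadrant"
      by (simp add: \<Phi>_def maps_quadrant_def case_prod_beta)
  qed
  have "continuous_on quadrant \<Phi>"
    unfolding \<Phi>_def by (intro continuous_intros C1_quadrant_continuous[OF G])
  then have cont: "continuous_on quadrant (\<lambda>p. A (\<Phi> p))" "continuous_on quadrant (\<lambda>p. B (\<Phi> p))"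
    using continuous_on_compose2[OF has_partials_onD(1)[OF AB] _ image]
      continuous_on_compose2[OF has_partials_onD(2)[OF AB] _ image] by simp_all
  have "((\<lambda>(x, y). F (G x y) x) has_derivative
      (\<lambda>(h, k). (A (\<Phi> p) * C p + B (\<Phi> p)) * h + A (\<Phi> p) * D p * k)) (at p within quadrant)"
    if p: "p \<in> quadrant" for p
  proof -
    have "(\<Phi> has_derivative (\<lambda>v. ((\<lambda>(h, k). C p * h + D p * k) v, fst v))) (at p within quadrant)"
      unfolding \<Phi>_def by (intro has_derivative_Pair has_partials_onD(3)[OF CD p] has_derivative_fst has_derivative_ident)
    from has_derivative_in_compose2[OF has_partials_onD(3)[OF AB] image p this]
    have "((\<lambda>p. (\<lambda>(x, y). F x y) (\<Phi> p)) has_derivative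
        (\<lambda>v. (\<lambda>(h, k). A (\<Phi> p) * h + B (\<Phi> p) * k) ((\<lambda>(h, k). C p * h + D p * k) v, fst v)))
        (at p within quadrant)" by simp
    moreover have "(\<lambda>p. (\<lambda>(x, y). F x y) (\<Phi> p)) = (\<lambda>(x, y). F (G x y) x)"
      by (auto simp: \<Phi>_def)
    moreover have "(\<lambda>v. (\<lambda>(h, k). A (\<Phi> p) * h + B (\<Phi> p) * k) ((\<lambda>(h, k). C p * h + D p * k) v, fst v)) =
        (\<lambda>(h, k). (A (\<Phi> p) * C p + B (\<Phi> p)) * h + A (\<Phi> p) * D p * k)"
      by (auto simp: algebra_simps)
    ultimately show ?thesis by (simp only:)
  qed
  moreover have "continuous_on quadrant (\<lambda>p. A (\<Phi> p) * C p + B (\<Phi> p))"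
    "continuous_on quadrant (\<lambda>p. A (\<Phi> p) * D p)"
    by (intro continuous_intros cont has_partials_onD[OF CD])+
  ultimately have F': "has_partials_on_quadrant (\<lambda>x y. F (G x y) x)
      (\<lambda>p. A (\<Phi> p) * C p + B (\<Phi> p)) (\<lambda>p. A (\<Phi> p) * D p)"
    unfolding has_partials_on_quadrant_def by (intro conjI ballI)
  show ?thesis
    unfolding C1_quadrant_iff_has_partials by (rule exI, rule exI, rule F')
qed

lemma C1_quadrant_expansion:
  assumes "C1_quadrant F" "maps_quadrant F"
  shows "C1_quadrant (expansion F j)"
proof (induction j)
  case (Suc j)
  then show ?case
    using C1_quadrant_substitute[OF Suc assms] by simp
qed (simp add: assms)

section \<open>Consequences of the derivative bound at the fixed point\<close>

lemma has_partials_interior: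
  assumes F: "has_partials_on_quadrant F D1 D2" and "0 < x" "0 < y"
  shows "((\<lambda>s. F s y) has_field_derivative D1 (x, y)) (at x)"
    and "((\<lambda>t. F x t) has_field_derivative D2 (x, y)) (at y)"
    and "x = y \<Longrightarrow> ((\<lambda>t. F t t) has_field_derivative D1 (x, y) + D2 (x, y)) (at x)"
proof -
  have "(x, y) \<in> interior quadrant"
    using assms by (simp add: interior_Times)
  then have "at (x, y) within quadrant = at (x, y)"
    by (rule at_within_interior)
  moreover have "(x, y) \<in> quadrant"
    using assms by simp
  ultimately have at: "((\<lambda>(x, y). F x y) has_derivative (\<lambda>(h, k). D1 (x, y) * h + D2 (x, y) * k)) (at (x, y))"
    using has_partials_onD(3)[OF F] by metis
  have "((\<lambda>s. (s, y)) has_derivative (\<lambda>h. (h, 0))) (at x)"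
    by (auto intro!: derivative_eq_intros)
  from has_derivative_compose[OF this at]
  show "((\<lambda>s. F s y) has_field_derivative D1 (x, y)) (at x)"
    by (simp add: has_field_derivative_def)
  have "((\<lambda>t. (x, t)) has_derivative (\<lambda>h. (0, h))) (at y)"
    by (auto intro!: derivative_eq_intros)
  from has_derivative_compose[OF this at]
  show "((\<lambda>t. F x t) has_field_derivative D2 (x, y)) (at y)"
    by (simp add: has_field_derivative_def)
  have diag: "((\<lambda>t. (t, t)) has_derivative (\<lambda>h. (h, h))) (at x)"
    by (auto intro!: derivative_eq_intros)
  show "((\<lambda>t. F t t) has_field_derivative D1 (x, y) + D2 (x, y)) (at x)" if "x = y"
  proof -
    have "((\<lambda>t. F t t) has_derivative (\<lambda>h. D1 (x, y) * h + D2 (x, y) * h)) (at x)"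
      using has_derivative_compose[OF diag at[folded that]] that by simp
    then show ?thesis
      unfolding has_field_derivative_def
      by (rule has_derivative_eq_rhs) (auto simp: distrib_right)
  qed
qed

lemma has_partials_deriv_at_1:
  assumes "has_partials_on_quadrant F D1 D2"
  shows "partial1 F 1 1 = D1 (1, 1)" "partial2 F 1 1 = D2 (1, 1)"
  using DERIV_imp_deriv[OF has_partials_interior(1)[OF assms, of 1 1]]
    DERIV_imp_deriv[OF has_partials_interior(2)[OF assms, of 1 1]]
  by (simp_all add: partial1_def partial2_def)

text \<open>
  The second partial derivative is continuous, so it stays below \<open>1\<close> in a box around \<open>(1, 1)\<close>,
  and the mean value theorem applies along vertical segments of this box.
\<close>

lemma locally_contracting_second_argument:
  assumes "C1_quadrant F" "partial2 F 1 1 < 1"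
  shows "\<exists>\<delta>>0. \<forall>x y y'. \<bar>x - 1\<bar> < \<delta> \<longrightarrow> \<bar>y - 1\<bar> < \<delta> \<longrightarrow> \<bar>y' - 1\<bar> < \<delta> \<longrightarrow> y < y' \<longrightarrow>
         F x y' - F x y < y' - y"
proof -
  obtain D1 D2 where D: "has_partials_on_quadrant F D1 D2"
    using assms(1) by (rule C1_quadrantE)
  have "D2 (1, 1) < 1"
    using assms(2) by (simp add: has_partials_deriv_at_1[OF D])
  moreover have "isCont D2 (1, 1)"
    using has_partials_onD(2)[OF D] by (rule continuous_on_interior) (simp add: interior_Times)
  ultimately have "\<forall>\<^sub>F p in nhds (1, 1). D2 p < 1"
    unfolding isCont_def by (metis order_tendstoD(2) tendsto_at_iff_tendsto_nhds)
  then obtain d where "d > 0" and d: "\<And>p. dist p (1, 1) < d \<Longrightarrow> D2 p < 1"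
    unfolding eventually_nhds_metric by blast
  \<comment> \<open>The bound \<open>1\<close> keeps the box inside the open quadrant; \<open>d / 2\<close> is enough because the
    Euclidean distance is at most the sum of the coordinate distances.\<close>
  define \<delta> where "\<delta> = min 1 (d / 2)"
  have "F x y' - F x y < y' - y"
    if "\<bar>x - 1\<bar> < \<delta>" "\<bar>y - 1\<bar> < \<delta>" "\<bar>y' - 1\<bar> < \<delta>" "y < y'" for x y y'
  proof -
    have near: "0 < x" "0 < t" "D2 (x, t) < 1" if "y \<le> t" "t \<le> y'" for t
    proof -
      have small: "\<bar>x - 1\<bar> < \<delta>" "\<bar>t - 1\<bar> < \<delta>"
        using that \<open>\<bar>x - 1\<bar> < \<delta>\<close> \<open>\<bar>y - 1\<bar> < \<delta>\<close> \<open>\<bar>y' - 1\<bar> < \<delta>\<close> by auto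
      then show "0 < x" "0 < t" by (auto simp: \<delta>_def)
      have "dist (x, t) (1, 1) \<le> \<bar>x - 1\<bar> + \<bar>t - 1\<bar>"
        using sqrt_sum_squares_le_sum_abs by (simp add: dist_Pair_Pair dist_real_def)
      then show "D2 (x, t) < 1"
        using small by (intro d) (simp add: \<delta>_def)
    qed
    obtain t where "y < t" "t < y'" "F x y' - F x y = (y' - y) * D2 (x, t)"
      using MVT2[OF \<open>y < y'\<close>, of "F x" "\<lambda>t. D2 (x, t)"] has_partials_interior(2)[OF D] near by metis
    then show ?thesis
      using near(3)[of t] \<open>y < y'\<close> by simp
  qed
  moreover have "\<delta> > 0" using \<open>d > 0\<close> by (simp add: \<delta>_def)
  ultimately show ?thesis by blast
qed

text \<open>
  A wrong sign at \<open>x\<close> would yield a second fixed point: on \<open>[0, x]\<close> if \<open>x < 1\<close>, because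
  \<open>F 0 0 \<ge> 0\<close>; on \<open>[m, x]\<close> if \<open>x > 1\<close>, where \<open>m\<close> is a point slightly above \<open>1\<close> with \<open>F m m < m\<close>.
  Such an \<open>m\<close> exists because \<open>t \<mapsto> F t t - t\<close> vanishes at \<open>1\<close> with a negative derivative there.
\<close>

lemma diagonal_side:
  assumes "C1_quadrant F" "maps_quadrant F" and unique: "fixed_points F = {1}"
    and "partial1 F 1 1 + partial2 F 1 1 < 1"
  shows "0 \<le> x \<Longrightarrow> x < 1 \<Longrightarrow> x < F x x" and "1 < x \<Longrightarrow> F x x < x"
proof -
  have fix_iff: "F t t = t \<longleftrightarrow> t = 1" if "0 \<le> t" for t
    using unique that by (auto simp: fixed_points_def set_eq_iff)
  have cont: "continuous_on {a..b} (\<lambda>t. F t t - t)" if "0 \<le> a" for a b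
  proof -
    have "continuous_on {a..b} (\<lambda>t. (\<lambda>(x, y). F x y) (t, t))"
      by (rule continuous_on_compose2[OF C1_quadrant_continuous[OF assms(1)]])
        (use that in \<open>auto intro!: continuous_intros\<close>)
    then show ?thesis by (auto intro!: continuous_intros)
  qed
  show "x < F x x" if x: "0 \<le> x" "x < 1"
  proof (rule ccontr)
    assume "\<not> x < F x x"
    then obtain t where "0 \<le> t" "t \<le> x" "F t t - t = 0"
      using IVT2'[of "\<lambda>t. F t t - t" x 0 0] cont[of 0 x] x assms(2)
      by (auto simp: maps_quadrant_def)
    then show False using fix_iff[of t] x by auto
  qed
  show "F x x < x" if x: "1 < x"
  proof (rule ccontr)
    assume not_less: "\<not> F x x < x"
    obtain D1 D2 where D: "has_partials_on_quadrant F D1 D2"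
      using assms(1) by (rule C1_quadrantE)
    have "D1 (1, 1) + D2 (1, 1) < 1"
      using assms(4) by (simp add: has_partials_deriv_at_1[OF D])
    moreover have "((\<lambda>t. F t t - t) has_field_derivative D1 (1, 1) + D2 (1, 1) - 1) (at 1)"
      by (intro DERIV_diff has_partials_interior(3)[OF D] DERIV_ident) simp_all
    ultimately obtain d where d: "d > 0" "\<And>h. 0 < h \<Longrightarrow> h < d \<Longrightarrow> F (1 + h) (1 + h) - (1 + h) < F 1 1 - 1"
      using DERIV_neg_dec_right[of "\<lambda>t. F t t - t" "D1 (1, 1) + D2 (1, 1) - 1" 1] by force
    define m where "m = 1 + min (d / 2) (x - 1)"
    have "F m m < m" "1 < m" "m \<le> x"
      using d(2)[of "min (d / 2) (x - 1)"] fix_iff[of 1] \<open>d > 0\<close> x by (auto simp: m_def min_def)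
    then obtain t where "m \<le> t" "F t t - t = 0"
      using IVT'[of "\<lambda>t. F t t - t" m 0 x] cont[of m x] not_less by auto
    then show False using fix_iff[of t] \<open>1 < m\<close> by auto
  qed
qed

section \<open>The enveloping theorem\<close>

theorem theorem3p11:
  fixes F0 :: "real \<Rightarrow> real \<Rightarrow> real" and j :: nat and g :: "real \<Rightarrow> real"
  assumes F0_maps: "maps_quadrant F0"
    and F0_smooth: "C1_quadrant F0"
    and F0_fix: "F0 1 1 = 1"
    and Fj_increasing: "\<forall>x\<ge>0. strict_mono_on {0..} (\<lambda>y. expansion F0 j x y)"
    and Fj_standing: "standing_assumptions (expansion F0 j)"
    and unique_fix: "fixed_points (expansion F0 j) = {1}"
    and LAS: "LAS_at_1 F0"
    and g_maps: "g ` {0..} \<subseteq> {0..}"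
    and g_continuous: "continuous_on {0..} g"
    and g_decreasing: "strict_antimono_on {0..} g"
    and between: "\<forall>x\<ge>0. x \<noteq> 1 \<longrightarrow>
           min x (g x) < expansion F0 j x (g x) \<and> expansion F0 j x (g x) < max x (g x)"
  shows "enveloping g (expansion F0 j)"
proof -
  let ?F = "expansion F0 j"
  have C1: "C1_quadrant ?F" and maps: "maps_quadrant ?F"
    using F0_maps F0_smooth by (simp_all add: C1_quadrant_expansion maps_quadrant_expansion)
  have "\<bar>partial1 ?F 1 1\<bar> + \<bar>partial2 ?F 1 1\<bar> < 1" and conn: "connected (y_curve ?F)"
    using Fj_standing unfolding standing_assumptions_def by (blast, blast)
  then have partials: "partial1 ?F 1 1 + partial2 ?F 1 1 < 1" "partial2 ?F 1 1 < 1"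
    by linarith+
  interpret squeezed_feedback ?F g
  proof
    show "continuous_on quadrant (\<lambda>(x, y). ?F x y)"
      by (rule C1_quadrant_continuous[OF C1])
    show "0 \<le> ?F x y" if "0 \<le> x" "0 \<le> y" for x y
      using maps that unfolding maps_quadrant_def by blast
    show "strict_mono_on {0..} (?F x)" if "0 \<le> x" for x
      using Fj_increasing that by blast
    show "?F 1 1 = 1"
      using unique_fix by (auto simp: fixed_points_def)
    show "x < ?F x x" if "0 \<le> x" "x < 1" for x
      using diagonal_side(1)[OF C1 maps unique_fix partials(1)] that .
    show "?F x x < x" if "1 < x" for x
      using diagonal_side(2)[OF C1 maps unique_fix partials(1)] that .
    show "\<exists>\<delta>>0. \<forall>x y y'. \<bar>x - 1\<bar> < \<delta> \<longrightarrow> \<bar>y - 1\<bar> < \<delta> \<longrightarrow> \<bar>y' - 1\<bar> < \<delta> \<longrightarrow> y < y' \<longrightarrow>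
        ?F x y' - ?F x y < y' - y"
      by (rule locally_contracting_second_argument[OF C1 partials(2)])
    show "0 \<le> g x" if "0 \<le> x" for x
      using g_maps that by auto
    show "min x (g x) < ?F x (g x) \<and> ?F x (g x) < max x (g x)" if "0 \<le> x" "x \<noteq> 1" for x
      using between that by blast
  qed (fact conn g_continuous g_decreasing)+
  show ?thesis by (rule enveloping)
qed

end
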